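(* Let $A$ be a Banach algebra and let $D:A\to A^*$ be a continuous derivation such that $A^*\subseteq D''(A^{**})$. If $D'':A^{**}\to A^{***}$ is a derivation, then $A$ is Arens regular.
   Context: A derivation from a Banach algebra $A$ into a Banach $A$-bimodule $B$ is a bounded linear map with $D(ab)=aD(b)+D(a)b$. $D''$ denotes the second transpose of $D$, and $A^*$ is canonically embedded in $A^{***}$. $A^{**}$ carries the first Arens product: if $a_\alpha\to m$ and $b_\beta\to n$ weak$^*$ with $a_\alpha,b_\beta\in A$, then $\langle m.n,f\rangle=\lim_\alpha\lim_\beta\langle f,a_\alpha b_\beta\rangle$ for $f\in A^*$; the second Arens product is $\langle m\Diamond n,f\rangle=\lim_\beta\lim_\alpha\langle f,a_\alpha b_\beta\rangle$. $A^{***}=(A^{**})^*$ is the dual $A^{**}$-bimodule of $A^{**}$. $A$ is Arens regular if the two Arens products coincide on $A^{**}$. *)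

theory Defs
  imports "HOL-Analysis.Analysis"
begin

text \<open>
  The scalar field is a type \<open>'k\<close> of class \<open>real_normed_field\<close>; by the theorems of
  Gelfand--Mazur and Frobenius such a field is isometrically the real or the complex numbers, so
  real and complex Banach algebras are treated at once.  The library's dual spaces (bounded
  linear functions into a fixed type) are real-linear only and a \<open>'k\<close>-linear dual is not a type,
  so normed spaces over \<open>'k\<close> are given by a carrier with operations.
\<close>

record ('k, 'v) nspace =
  carr :: "'v set"
  vadd :: "'v \<Rightarrow> 'v \<Rightarrow> 'v"
  vscale :: "'k \<Rightarrow> 'v \<Rightarrow> 'v"
  vnorm :: "'v \<Rightarrow> real"

definition bdd_linear ::
  "('k, 'v) nspace \<Rightarrow> ('k, 'w) nspace \<Rightarrow> ('v \<Rightarrow> 'w) \<Rightarrow> bool" where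
  "bdd_linear X Y T \<longleftrightarrow>
     (\<forall>x\<in>carr X. T x \<in> carr Y) \<and>
     (\<forall>x\<in>carr X. \<forall>y\<in>carr X. T (vadd X x y) = vadd Y (T x) (T y)) \<and>
     (\<forall>c. \<forall>x\<in>carr X. T (vscale X c x) = vscale Y c (T x)) \<and>
     (\<exists>K. \<forall>x\<in>carr X. vnorm Y (T x) \<le> K * vnorm X x)"

definition scalars :: "('k::real_normed_field, 'k) nspace" where
  "scalars = \<lparr>carr = UNIV, vadd = (+), vscale = (*), vnorm = norm\<rparr>"

text \<open>
  The Banach dual.  Functionals are made total by the value 0 off the carrier, so that equality of
  elements of a dual is equality of functions; all maps into a dual below follow this convention.
\<close>

definition dual ::
  "('k::real_normed_field, 'v) nspace \<Rightarrow> ('k, 'v \<Rightarrow> 'k) nspace" where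
  "dual X =
     \<lparr>carr = {\<phi>. bdd_linear X scalars \<phi> \<and> (\<forall>x. x \<notin> carr X \<longrightarrow> \<phi> x = 0)},
      vadd = (\<lambda>\<phi> \<psi> x. \<phi> x + \<psi> x),
      vscale = (\<lambda>c \<phi> x. c * \<phi> x),
      vnorm = (\<lambda>\<phi>. Sup {norm (\<phi> x) |x. x \<in> carr X \<and> vnorm X x \<le> 1})\<rparr>"

text \<open>The transpose \<open>dual Y \<rightarrow> dual X\<close> of a map \<open>T : X \<rightarrow> Y\<close>.\<close>

definition transp ::
  "('k, 'v) nspace \<Rightarrow> ('v \<Rightarrow> 'w) \<Rightarrow> ('w \<Rightarrow> 'k::zero) \<Rightarrow> 'v \<Rightarrow> 'k" where
  "transp X T \<psi> = (\<lambda>x. if x \<in> carr X then \<psi> (T x) else 0)"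

text \<open>The canonical embedding \<open>X \<rightarrow> dual (dual X)\<close>.\<close>

definition canon ::
  "('k::real_normed_field, 'v) nspace \<Rightarrow> 'v \<Rightarrow> ('v \<Rightarrow> 'k) \<Rightarrow> 'k" where
  "canon X x = (\<lambda>\<phi>. if \<phi> \<in> carr (dual X) then \<phi> x else 0)"

text \<open>
  The module actions of an algebra with underlying space \<open>X\<close> and product \<open>mul\<close> on \<open>dual X\<close>:
  \<open>\<langle>a \<cdot> \<phi>, x\<rangle> = \<langle>\<phi>, x a\<rangle>\<close> and \<open>\<langle>\<phi> \<cdot> a, x\<rangle> = \<langle>\<phi>, a x\<rangle>\<close>.
\<close>

definition dual_left ::
  "('k, 'v) nspace \<Rightarrow> ('v \<Rightarrow> 'v \<Rightarrow> 'v) \<Rightarrow> 'v \<Rightarrow> ('v \<Rightarrow> 'k::zero) \<Rightarrow> 'v \<Rightarrow> 'k" where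
  "dual_left X mul a \<phi> = (\<lambda>x. if x \<in> carr X then \<phi> (mul x a) else 0)"

definition dual_right ::
  "('k, 'v) nspace \<Rightarrow> ('v \<Rightarrow> 'v \<Rightarrow> 'v) \<Rightarrow> ('v \<Rightarrow> 'k::zero) \<Rightarrow> 'v \<Rightarrow> 'v \<Rightarrow> 'k" where
  "dual_right X mul \<phi> a = (\<lambda>x. if x \<in> carr X then \<phi> (mul a x) else 0)"

definition derivation ::
  "('k, 'v) nspace \<Rightarrow> ('v \<Rightarrow> 'v \<Rightarrow> 'v) \<Rightarrow>
   ('k, 'w) nspace \<Rightarrow> ('v \<Rightarrow> 'w \<Rightarrow> 'w) \<Rightarrow> ('w \<Rightarrow> 'v \<Rightarrow> 'w) \<Rightarrow> ('v \<Rightarrow> 'w) \<Rightarrow> bool" where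
  "derivation X mul Y lact ract D \<longleftrightarrow>
     bdd_linear X Y D \<and>
     (\<forall>a\<in>carr X. \<forall>b\<in>carr X. D (mul a b) = vadd Y (lact a (D b)) (ract (D a) b))"

definition dual_derivation ::
  "('k::real_normed_field, 'v) nspace \<Rightarrow> ('v \<Rightarrow> 'v \<Rightarrow> 'v) \<Rightarrow> ('v \<Rightarrow> 'v \<Rightarrow> 'k) \<Rightarrow> bool" where
  "dual_derivation X mul D \<longleftrightarrow>
     derivation X mul (dual X) (dual_left X mul) (dual_right X mul) D"

text \<open>
  A Banach algebra over \<open>'k\<close>, not necessarily unital: the ring structure, the submultiplicative
  norm and completeness come from the type classes, and \<open>sc\<close> is the scalar multiplication.
\<close>

locale banach_algebra = vector_space sc
  for sc :: "'k::real_normed_field \<Rightarrow> 'a::{real_normed_algebra, banach} \<Rightarrow> 'a" +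
  assumes sc_of_real: "sc (of_real r) x = r *\<^sub>R x"
    and norm_sc: "norm (sc c x) = norm c * norm x"
    and sc_mult_left: "sc c x * y = sc c (x * y)"
    and sc_mult_right: "x * sc c y = sc c (x * y)"

definition alg :: "('k \<Rightarrow> 'a \<Rightarrow> 'a) \<Rightarrow> ('k, 'a::real_normed_algebra) nspace" where
  "alg sc = \<lparr>carr = UNIV, vadd = (+), vscale = sc, vnorm = norm\<rparr>"

abbreviation "alg_dual sc \<equiv> dual (alg sc)"
abbreviation "alg_bidual sc \<equiv> dual (alg_dual sc)"

text \<open>
  Nets in the algebra are represented by the proper filters they generate on it; conversely every
  proper filter arises from a net, and neither convergence nor (iterated) limits see the
  difference.
\<close>

definition wstar_conv ::
  "('k \<Rightarrow> 'a \<Rightarrow> 'a) \<Rightarrow> 'a::real_normed_algebra filter \<Rightarrow>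
   (('a \<Rightarrow> 'k::real_normed_field) \<Rightarrow> 'k) \<Rightarrow> bool" where
  "wstar_conv sc F m \<longleftrightarrow> F \<noteq> bot \<and> (\<forall>f\<in>carr (alg_dual sc). (f \<longlongrightarrow> m f) F)"

text \<open>\<open>iter_lim F G h c\<close> says that \<open>c\<close> is the limit along \<open>F\<close> of the limits along \<open>G\<close> of \<open>h a b\<close>.\<close>

definition iter_lim ::
  "'a filter \<Rightarrow> 'b filter \<Rightarrow> ('a \<Rightarrow> 'b \<Rightarrow> 'k::topological_space) \<Rightarrow> 'k \<Rightarrow> bool" where
  "iter_lim F G h c \<longleftrightarrow> (\<exists>g. (\<forall>a. (h a \<longlongrightarrow> g a) G) \<and> (g \<longlongrightarrow> c) F)"

text \<open>
  The value of a product at \<open>f\<close> is the common value of the iterated limits for all approximating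
  nets; it exists and is unique by the lemmas \<open>arens1_ex1\<close> and \<open>arens2_ex1\<close> below.
\<close>

definition arens1 ::
  "('k \<Rightarrow> 'a \<Rightarrow> 'a) \<Rightarrow> (('a::real_normed_algebra \<Rightarrow> 'k::real_normed_field) \<Rightarrow> 'k) \<Rightarrow>
   (('a \<Rightarrow> 'k) \<Rightarrow> 'k) \<Rightarrow> ('a \<Rightarrow> 'k) \<Rightarrow> 'k" where
  "arens1 sc m n = (\<lambda>f. if f \<in> carr (alg_dual sc) then
     THE c. \<forall>F G. wstar_conv sc F m \<and> wstar_conv sc G n \<longrightarrow>
                  iter_lim F G (\<lambda>a b. f (a * b)) c
     else 0)"

definition arens2 ::
  "('k \<Rightarrow> 'a \<Rightarrow> 'a) \<Rightarrow> (('a::real_normed_algebra \<Rightarrow> 'k::real_normed_field) \<Rightarrow> 'k) \<Rightarrow>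
   (('a \<Rightarrow> 'k) \<Rightarrow> 'k) \<Rightarrow> ('a \<Rightarrow> 'k) \<Rightarrow> 'k" where
  "arens2 sc m n = (\<lambda>f. if f \<in> carr (alg_dual sc) then
     THE c. \<forall>F G. wstar_conv sc F m \<and> wstar_conv sc G n \<longrightarrow>
                  iter_lim G F (\<lambda>b a. f (a * b)) c
     else 0)"

definition arens_regular ::
  "('k::real_normed_field \<Rightarrow> 'a::real_normed_algebra \<Rightarrow> 'a) \<Rightarrow> bool" where
  "arens_regular sc \<longleftrightarrow>
     (\<forall>m\<in>carr (alg_bidual sc). \<forall>n\<in>carr (alg_bidual sc). arens1 sc m n = arens2 sc m n)"

definition second_transp ::
  "('k::real_normed_field \<Rightarrow> 'a::real_normed_algebra \<Rightarrow> 'a) \<Rightarrow> ('a \<Rightarrow> 'a \<Rightarrow> 'k) \<Rightarrow>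
   (('a \<Rightarrow> 'k) \<Rightarrow> 'k) \<Rightarrow> (('a \<Rightarrow> 'k) \<Rightarrow> 'k) \<Rightarrow> 'k" where
  "second_transp sc D = transp (alg_bidual sc) (transp (alg sc) D)"

context banach_algebra
begin

lemma alg_dual_iff:
  "f \<in> carr (alg_dual sc) \<longleftrightarrow>
     (\<forall>x y. f (x + y) = f x + f y) \<and> (\<forall>c x. f (sc c x) = c * f x) \<and>
     (\<exists>K. \<forall>x. norm (f x) \<le> K * norm x)"
  by (simp add: dual_def bdd_linear_def alg_def scalars_def)

lemma alg_dual_bound:
  assumes "f \<in> carr (alg_dual sc)"
  obtains K where "K \<ge> 0" "\<And>x. norm (f x) \<le> K * norm x"
proof -
  obtain K where K: "\<And>x. norm (f x) \<le> K * norm x"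
    using assms alg_dual_iff by blast
  have "norm (f x) \<le> max K 0 * norm x" for x
    using K[of x] by (meson max.cobounded1 mult_right_mono norm_ge_zero order_trans)
  then show thesis using that[of "max K 0"] by simp
qed

lemma alg_dual_translate_right:
  assumes "f \<in> carr (alg_dual sc)"
  shows "(\<lambda>b. f (a * b)) \<in> carr (alg_dual sc)"
proof -
  obtain K where K: "K \<ge> 0" "\<And>x. norm (f x) \<le> K * norm x"
    using alg_dual_bound[OF assms] by blast
  have "norm (f (a * b)) \<le> (K * norm a) * norm b" for b
    using K(2)[of "a * b"] mult_left_mono[OF norm_mult_ineq[of a b] K(1)]
    by (simp add: mult.assoc)
  then show ?thesis
    using assms unfolding alg_dual_iff by (auto simp: distrib_left sc_mult_right)
qed

lemma alg_dual_translate_left: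
  assumes "f \<in> carr (alg_dual sc)"
  shows "(\<lambda>a. f (a * b)) \<in> carr (alg_dual sc)"
proof -
  obtain K where K: "K \<ge> 0" "\<And>x. norm (f x) \<le> K * norm x"
    using alg_dual_bound[OF assms] by blast
  have "norm (f (a * b)) \<le> (K * norm b) * norm a" for a
    using K(2)[of "a * b"] mult_left_mono[OF norm_mult_ineq[of a b] K(1)]
    by (simp add: mult_ac)
  then show ?thesis
    using assms unfolding alg_dual_iff by (auto simp: distrib_right sc_mult_left)
qed

lemma alg_dual_comb:
  assumes "f \<in> carr (alg_dual sc)" "g \<in> carr (alg_dual sc)"
  shows "(\<lambda>x. f x + c * g x) \<in> carr (alg_dual sc)"
proof -
  obtain K where K: "\<And>x. norm (f x) \<le> K * norm x"
    using alg_dual_bound[OF assms(1)] by blast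
  obtain L where L: "\<And>x. norm (g x) \<le> L * norm x"
    using alg_dual_bound[OF assms(2)] by blast
  have "norm (f x + c * g x) \<le> (K + norm c * L) * norm x" for x
  proof -
    have "norm (f x + c * g x) \<le> norm (f x) + norm c * norm (g x)"
      by (metis norm_mult norm_triangle_ineq)
    also have "\<dots> \<le> K * norm x + norm c * (L * norm x)"
      by (intro add_mono mult_left_mono K L) auto
    finally show ?thesis by (simp add: algebra_simps)
  qed
  then have "\<exists>M. \<forall>x. norm (f x + c * g x) \<le> M * norm x" by blast
  then show ?thesis
    using assms unfolding alg_dual_iff by (simp add: algebra_simps)
qed

lemma bidual_lin:
  assumes "m \<in> carr (alg_bidual sc)" "f \<in> carr (alg_dual sc)" "g \<in> carr (alg_dual sc)"
  shows "m (\<lambda>x. f x + c * g x) = m f + c * m g"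
proof -
  have z: "(\<lambda>x. 0) \<in> carr (alg_dual sc)"
    unfolding alg_dual_iff by (auto intro: exI[of _ 0])
  have cg: "(\<lambda>x. c * g x) \<in> carr (alg_dual sc)"
    using alg_dual_comb[OF z assms(3), of c] by simp
  have 1: "m (\<lambda>x. u x + v x) = m u + m v"
    if "u \<in> carr (alg_dual sc)" "v \<in> carr (alg_dual sc)" for u v
    using assms(1) that
    by (auto simp: dual_def[of "alg_dual sc"] bdd_linear_def scalars_def)
       (auto simp: dual_def)
  have 2: "m (\<lambda>x. c * u x) = c * m u" if "u \<in> carr (alg_dual sc)" for u
    using assms(1) that
    by (auto simp: dual_def[of "alg_dual sc"] bdd_linear_def scalars_def)
       (auto simp: dual_def)
  show ?thesis using 1[OF assms(2) cg] 2[OF assms(3)] by simp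
qed

lemma bidual_vanish:
  assumes "finite S" "S \<subseteq> carr (alg_dual sc)" "g \<in> carr (alg_dual sc)"
    and "m \<in> carr (alg_bidual sc)"
    and "\<forall>x. (\<forall>f\<in>S. f x = 0) \<longrightarrow> g x = 0"
    and "\<forall>f\<in>S. m f = f a0"
  shows "m g = g a0"
  using assms
proof (induction S arbitrary: g rule: finite_induct)
  case empty
  then have "m (\<lambda>x. g x + (-1) * g x) = m g + (-1) * m g"
    using bidual_lin by blast
  moreover have "(\<lambda>x. g x + (-1) * g x) = g" using empty by auto
  ultimately have "m g = 0" by simp
  moreover have "g a0 = 0" using empty by simp
  ultimately show ?case by (simp only:)
next
  case (insert h S)
  show ?case
  proof (cases "\<forall>x. (\<forall>f\<in>S. f x = 0) \<longrightarrow> h x = 0")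
    case True
    then show ?thesis using insert by auto
  next
    case False
    then obtain z0 where z0: "\<forall>f\<in>S. f z0 = 0" "h z0 \<noteq> 0" by blast
    define c where "c = - g z0 / h z0"
    have hd: "h \<in> carr (alg_dual sc)" using insert by auto
    let ?g = "\<lambda>x. g x + c * h x"
    have van: "?g x = 0" if x: "\<forall>f\<in>S. f x = 0" for x
    proof -
      define d where "d = - h x / h z0"
      have add: "u (x + sc d z0) = u x + d * u z0" if "u \<in> carr (alg_dual sc)" for u
        using that unfolding alg_dual_iff by simp
      have "d * h z0 = - h x" using z0 by (simp add: d_def)
      then have "\<forall>f\<in>insert h S. f (x + sc d z0) = 0"
        using insert.prems x z0 by (auto simp: add subset_iff)
      then have "g (x + sc d z0) = 0" using insert.prems by blast
      then have "g x + d * g z0 = 0" using add insert.prems by simp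
      moreover have "d * g z0 = c * h x" by (simp add: c_def d_def)
      ultimately show ?thesis by simp
    qed
    have "m ?g = ?g a0"
      using insert.IH[of ?g] insert.prems alg_dual_comb[OF insert.prems(2) hd] van by auto
    moreover have "m ?g = m g + c * m h"
      using bidual_lin insert.prems hd by blast
    ultimately show ?thesis using insert.prems by simp
  qed
qed

lemma bidual_interp:
  assumes "finite S" "S \<subseteq> carr (alg_dual sc)" "m \<in> carr (alg_bidual sc)"
  shows "\<exists>a. \<forall>f\<in>S. m f = f a"
  using assms
proof (induction S rule: finite_induct)
  case empty
  then show ?case by simp
next
  case (insert h S)
  then obtain a where a: "\<forall>f\<in>S. m f = f a" by auto
  show ?case
  proof (cases "\<forall>x. (\<forall>f\<in>S. f x = 0) \<longrightarrow> h x = 0")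
    case True
    then have "m h = h a"
      using bidual_vanish[of S h m a] insert a by auto
    then show ?thesis using a by auto
  next
    case False
    then obtain z where z: "\<forall>f\<in>S. f z = 0" "h z \<noteq> 0" by blast
    define d where "d = (m h - h a) / h z"
    have add: "u (a + sc d z) = u a + d * u z" if "u \<in> carr (alg_dual sc)" for u
      using that unfolding alg_dual_iff by simp
    have "d * h z = m h - h a" using z by (simp add: d_def)
    then have "\<forall>f\<in>insert h S. m f = f (a + sc d z)"
      using insert.prems a z by (auto simp: add subset_iff)
    then show ?thesis by blast
  qed
qed

lemma wstar_conv_ex:
  assumes m: "m \<in> carr (alg_bidual sc)"
  shows "\<exists>F. wstar_conv sc F m"
proof -
  let ?F = "INF f\<in>carr (alg_dual sc). principal {a. m f = f a}"
  have "?F \<noteq> bot"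
  proof
    assume "?F = bot"
    then have "eventually (\<lambda>_. False) ?F" by simp
    then have "\<exists>S\<subseteq>carr (alg_dual sc). finite S \<and>
      eventually (\<lambda>_. False) (INF f\<in>S. principal {a. m f = f a})"
      by (rule eventually_INF[THEN iffD1])
    then obtain S where S: "finite S" "S \<subseteq> carr (alg_dual sc)"
      "eventually (\<lambda>_. False) (INF f\<in>S. principal {a. m f = f a})"
      by blast
    obtain a where "\<forall>f\<in>S. m f = f a" using bidual_interp[OF S(1,2) m] by blast
    moreover have "(INF f\<in>S. principal {a. m f = f a}) = principal (\<Inter>f\<in>S. {a. m f = f a})"
      using S(1) by (simp add: INF_principal_finite)
    ultimately show False using S(3) by (auto simp: eventually_principal)
  qed
  moreover have "(f \<longlongrightarrow> m f) ?F" if f: "f \<in> carr (alg_dual sc)" for f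
  proof (rule tendsto_eventually)
    have "?F \<le> principal {a. m f = f a}" using f by (rule INF_lower)
    then have "eventually (\<lambda>a. a \<in> {a. m f = f a}) ?F" by (simp only: le_principal)
    then show "eventually (\<lambda>a. f a = m f) ?F" by (rule eventually_mono) simp
  qed
  ultimately show ?thesis unfolding wstar_conv_def by blast
qed

lemma bidual_bound:
  assumes "m \<in> carr (alg_bidual sc)"
  obtains K where "K \<ge> 0"
    "\<And>f L. f \<in> carr (alg_dual sc) \<Longrightarrow> (\<And>x. norm (f x) \<le> L * norm x) \<Longrightarrow> L \<ge> 0 \<Longrightarrow>
       norm (m f) \<le> K * L"
proof -
  obtain K where K: "\<forall>f\<in>carr (alg_dual sc). norm (m f) \<le> K * vnorm (alg_dual sc) f"
    using assms by (auto simp: dual_def[of "alg_dual sc"] bdd_linear_def scalars_def)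
  have "norm (m f) \<le> max K 0 * L"
    if f: "f \<in> carr (alg_dual sc)" and L: "\<And>x. norm (f x) \<le> L * norm x" "L \<ge> 0" for f L
  proof -
    let ?S = "{norm (f x) |x. norm x \<le> 1}"
    have v: "vnorm (alg_dual sc) f = Sup ?S" by (simp add: dual_def alg_def)
    have b: "s \<le> L" if "s \<in> ?S" for s
      using that L(1) L(2) by (auto intro: order_trans[OF L(1)] mult_left_le)
    have mem: "norm (f 0) \<in> ?S" by force
    have "Sup ?S \<le> L" using b mem by (intro cSup_least) auto
    moreover have "0 \<le> Sup ?S"
      using cSup_upper[OF mem] b by (meson bdd_aboveI norm_ge_zero order_trans)
    ultimately have "K * Sup ?S \<le> max K 0 * L"
      by (meson max.cobounded1 max.cobounded2 mult_left_mono mult_right_mono order_trans)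
    then show ?thesis using K f v by force
  qed
  then show thesis using that[of "max K 0"] by simp
qed

lemma bidual_act_right:
  assumes n: "n \<in> carr (alg_bidual sc)" and f: "f \<in> carr (alg_dual sc)"
  shows "(\<lambda>a. n (\<lambda>b. f (a * b))) \<in> carr (alg_dual sc)"
proof -
  note t = alg_dual_translate_right[OF f]
  obtain K where K: "K \<ge> 0" "\<And>x. norm (f x) \<le> K * norm x"
    using alg_dual_bound[OF f] by blast
  obtain L where L: "\<And>g M. g \<in> carr (alg_dual sc) \<Longrightarrow>
      (\<And>x. norm (g x) \<le> M * norm x) \<Longrightarrow> M \<ge> 0 \<Longrightarrow> norm (n g) \<le> L * M"
    using bidual_bound[OF n] by blast
  have bd: "norm (n (\<lambda>b. f (a * b))) \<le> (L * K) * norm a" for a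
  proof -
    have "norm (f (a * b)) \<le> (K * norm a) * norm b" for b
      using K(2)[of "a * b"] mult_left_mono[OF norm_mult_ineq[of a b] K(1)]
      by (simp add: mult.assoc)
    then have "norm (n (\<lambda>b. f (a * b))) \<le> L * (K * norm a)"
      using L[OF t] K(1) by (meson mult_nonneg_nonneg norm_ge_zero)
    then show ?thesis by (simp add: mult.assoc)
  qed
  have lin: "n (\<lambda>b. f ((x + sc c y) * b)) = n (\<lambda>b. f (x * b)) + c * n (\<lambda>b. f (y * b))" for x y c
  proof -
    have "(\<lambda>b. f ((x + sc c y) * b)) = (\<lambda>b. f (x * b) + c * f (y * b))"
      using f unfolding alg_dual_iff by (simp add: distrib_right sc_mult_left)
    then show ?thesis using bidual_lin[OF n t t] by simp
  qed
  have z: "n (\<lambda>b. f (0 * b)) = 0" using bd[of 0] by simp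
  show ?thesis
    unfolding alg_dual_iff using lin[of _ 1] lin[of 0] z bd by auto
qed

lemma bidual_act_left:
  assumes n: "n \<in> carr (alg_bidual sc)" and f: "f \<in> carr (alg_dual sc)"
  shows "(\<lambda>b. n (\<lambda>a. f (a * b))) \<in> carr (alg_dual sc)"
proof -
  note t = alg_dual_translate_left[OF f]
  obtain K where K: "K \<ge> 0" "\<And>x. norm (f x) \<le> K * norm x"
    using alg_dual_bound[OF f] by blast
  obtain L where L: "\<And>g M. g \<in> carr (alg_dual sc) \<Longrightarrow>
      (\<And>x. norm (g x) \<le> M * norm x) \<Longrightarrow> M \<ge> 0 \<Longrightarrow> norm (n g) \<le> L * M"
    using bidual_bound[OF n] by blast
  have bd: "norm (n (\<lambda>a. f (a * b))) \<le> (L * K) * norm b" for b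
  proof -
    have "norm (f (a * b)) \<le> (K * norm b) * norm a" for a
      using K(2)[of "a * b"] mult_left_mono[OF norm_mult_ineq[of a b] K(1)]
      by (simp add: mult_ac)
    then have "norm (n (\<lambda>a. f (a * b))) \<le> L * (K * norm b)"
      using L[OF t] K(1) by (meson mult_nonneg_nonneg norm_ge_zero)
    then show ?thesis by (simp add: mult.assoc)
  qed
  have lin: "n (\<lambda>a. f (a * (x + sc c y))) = n (\<lambda>a. f (a * x)) + c * n (\<lambda>a. f (a * y))" for x y c
  proof -
    have "(\<lambda>a. f (a * (x + sc c y))) = (\<lambda>a. f (a * x) + c * f (a * y))"
      using f unfolding alg_dual_iff by (simp add: distrib_left sc_mult_right)
    then show ?thesis using bidual_lin[OF n t t] by simp
  qed
  have z: "n (\<lambda>a. f (a * 0)) = 0" using bd[of 0] by simp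
  show ?thesis
    unfolding alg_dual_iff using lin[of _ 1] lin[of 0] z bd by auto
qed

lemma iter_lim_unique:
  fixes c d :: "'b::t2_space"
  assumes "F \<noteq> bot" "G \<noteq> bot" "iter_lim F G h c" "iter_lim F G h d"
  shows "c = d"
proof -
  obtain g where g: "\<forall>a. (h a \<longlongrightarrow> g a) G" "(g \<longlongrightarrow> c) F"
    using assms(3) iter_lim_def by metis
  obtain g' where g': "\<forall>a. (h a \<longlongrightarrow> g' a) G" "(g' \<longlongrightarrow> d) F"
    using assms(4) iter_lim_def by metis
  have "g = g'" using g(1) g'(1) assms(2) tendsto_unique by blast
  then show ?thesis using g(2) g'(2) assms(1) tendsto_unique by blast
qed

lemma arens1_iter_lim:
  assumes "n \<in> carr (alg_bidual sc)" "f \<in> carr (alg_dual sc)"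
    and "wstar_conv sc F m" "wstar_conv sc G n"
  shows "iter_lim F G (\<lambda>a b. f (a * b)) (m (\<lambda>a. n (\<lambda>b. f (a * b))))"
  using assms bidual_act_right[OF assms(1,2)] alg_dual_translate_right[OF assms(2)]
  unfolding iter_lim_def wstar_conv_def by (intro exI[of _ "\<lambda>a. n (\<lambda>b. f (a * b))"]) auto

lemma arens2_iter_lim:
  assumes "m \<in> carr (alg_bidual sc)" "f \<in> carr (alg_dual sc)"
    and "wstar_conv sc F m" "wstar_conv sc G n"
  shows "iter_lim G F (\<lambda>b a. f (a * b)) (n (\<lambda>b. m (\<lambda>a. f (a * b))))"
  using assms bidual_act_left[OF assms(1,2)] alg_dual_translate_left[OF assms(2)]
  unfolding iter_lim_def wstar_conv_def by (intro exI[of _ "\<lambda>b. m (\<lambda>a. f (a * b))"]) auto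

lemma arens1_ex1:
  assumes "m \<in> carr (alg_bidual sc)" "n \<in> carr (alg_bidual sc)" "f \<in> carr (alg_dual sc)"
  shows "\<exists>!c. \<forall>F G. wstar_conv sc F m \<and> wstar_conv sc G n \<longrightarrow>
                    iter_lim F G (\<lambda>a b. f (a * b)) c"
proof -
  obtain F G where FG: "wstar_conv sc F m" "wstar_conv sc G n"
    using wstar_conv_ex assms by metis
  then have "F \<noteq> bot" "G \<noteq> bot" unfolding wstar_conv_def by auto
  then show ?thesis
    using FG arens1_iter_lim[OF assms(2,3)]
    by (intro ex_ex1I) (blast, metis iter_lim_unique)
qed

lemma arens2_ex1:
  assumes "m \<in> carr (alg_bidual sc)" "n \<in> carr (alg_bidual sc)" "f \<in> carr (alg_dual sc)"
  shows "\<exists>!c. \<forall>F G. wstar_conv sc F m \<and> wstar_conv sc G n \<longrightarrow>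
                    iter_lim G F (\<lambda>b a. f (a * b)) c"
proof -
  obtain F G where FG: "wstar_conv sc F m" "wstar_conv sc G n"
    using wstar_conv_ex assms by metis
  then have "F \<noteq> bot" "G \<noteq> bot" unfolding wstar_conv_def by auto
  then show ?thesis
    using FG arens2_iter_lim[OF assms(1,3)]
    by (intro ex_ex1I) (blast, metis iter_lim_unique)
qed

end

end

theory Submission
  imports Defs
begin

text \<open>
  Expanding \<open>\<langle>D''(m.n), p\<rangle>\<close> with the Leibniz rule of \<open>D\<close>, the summand coming from \<open>D(a)b\<close> is always
  \<open>\<langle>D''(m), n.p\<rangle>\<close>.  Hence \<open>D''\<close> is a derivation iff
  \<open>\<langle>m, a \<mapsto> \<langle>D''(n), p.a\<rangle>\<rangle> = \<langle>D''(n), p.m\<rangle>\<close> for all \<open>m\<close>, \<open>n\<close>, \<open>p\<close>.  If \<open>D''(n)\<close> is a functional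
  \<open>f\<close> on \<open>A\<close>, the left side is \<open>\<langle>p \<diamond> m, f\<rangle>\<close> and the right side is \<open>\<langle>p.m, f\<rangle>\<close>.
\<close>

context banach_algebra
begin

text \<open>\<open>vnorm\<close> is a bare \<open>Sup\<close>, informative only for a set bounded
  above; boundedness of \<open>f\<close> supplies that. The operator norm thus becomes an admissible
  constant \<open>L\<close> in \<open>bidual_bound\<close>.\<close>

lemma alg_dual_vnorm:
  assumes f: "f \<in> carr (alg_dual sc)"
  shows "0 \<le> vnorm (alg_dual sc) f" and "norm (f x) \<le> vnorm (alg_dual sc) f * norm x"
proof -
  let ?S = "{norm (f x) |x. norm x \<le> 1}"
  obtain K where K: "K \<ge> 0" "\<And>x. norm (f x) \<le> K * norm x"
    using alg_dual_bound[OF f] by blast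
  have v: "vnorm (alg_dual sc) f = Sup ?S" by (simp add: dual_def alg_def)
  have "s \<le> K" if "s \<in> ?S" for s
    using that K by (auto intro: order_trans[OF K(2)] mult_left_le)
  then have bdd: "bdd_above ?S" by (meson bdd_aboveI)
  have up: "norm (f y) \<le> vnorm (alg_dual sc) f" if "norm y \<le> 1" for y
    unfolding v using that by (intro cSup_upper[OF _ bdd]) auto
  show "0 \<le> vnorm (alg_dual sc) f" using order_trans[OF norm_ge_zero up[of 0]] by simp
  show "norm (f x) \<le> vnorm (alg_dual sc) f * norm x"
  proof (cases "x = 0")
    case True
    then show ?thesis using K(2)[of 0] by simp
  next
    case False
    \<comment> \<open>A real factor normalises \<open>x\<close> over any field \<open>'k\<close>:
      \<open>sc_of_real\<close> turns it into a scalar of \<open>'k\<close>, which \<open>f\<close>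
      respects.\<close>
    define r where "r = inverse (norm x)"
    have "f (r *\<^sub>R x) = of_real r * f x"
      using f unfolding alg_dual_iff by (metis sc_of_real)
    moreover have "norm (f (r *\<^sub>R x)) \<le> vnorm (alg_dual sc) f"
      using False by (intro up) (simp add: r_def)
    ultimately have "\<bar>r\<bar> * norm (f x) \<le> vnorm (alg_dual sc) f"
      by (simp add: norm_mult)
    then show ?thesis using False by (simp add: r_def field_simps)
  qed
qed

lemma dual_vadd: "vadd (dual X) f g = (\<lambda>x. f x + g x)"
  by (simp add: dual_def)

lemma dual_vscale: "vscale (dual X) c f = (\<lambda>x. c * f x)"
  by (simp add: dual_def)

lemma alg_dual_zero: "(\<lambda>x. 0) \<in> carr (alg_dual sc)"
  unfolding alg_dual_iff by (auto intro: exI[of _ 0])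

text \<open>Counterpart of \<open>bidual_bound\<close>: \<open>T\<close> is estimated through an
  arbitrary bound \<open>L\<close> of \<open>f\<close>, so no operator norm has to be computed. This
  suffices because \<open>vnorm\<close> is itself such an \<open>L\<close>.\<close>

lemma bidual_memI:
  assumes off: "\<And>f. f \<notin> carr (alg_dual sc) \<Longrightarrow> T f = 0"
    and lin: "\<And>f g c. f \<in> carr (alg_dual sc) \<Longrightarrow> g \<in> carr (alg_dual sc) \<Longrightarrow>
      T (\<lambda>x. f x + c * g x) = T f + c * T g"
    and bd: "\<And>f L. f \<in> carr (alg_dual sc) \<Longrightarrow> (\<And>x. norm (f x) \<le> L * norm x) \<Longrightarrow> L \<ge> 0 \<Longrightarrow>
      norm (T f) \<le> K * L"
  shows "T \<in> carr (alg_bidual sc)"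
proof -
  have z: "T (\<lambda>x. 0) = 0"
    using bd[OF alg_dual_zero, of 0] by simp
  have add: "T (\<lambda>x. f x + g x) = T f + T g"
    if "f \<in> carr (alg_dual sc)" "g \<in> carr (alg_dual sc)" for f g
    using lin[OF that, of 1] by simp
  have scale: "T (\<lambda>x. c * g x) = c * T g" if "g \<in> carr (alg_dual sc)" for g c
    using lin[OF alg_dual_zero that, of c] z by simp
  have "norm (T f) \<le> K * vnorm (alg_dual sc) f" if "f \<in> carr (alg_dual sc)" for f
    using bd that alg_dual_vnorm[OF that] by blast
  then have "bdd_linear (alg_dual sc) scalars T"
    by (auto simp: bdd_linear_def dual_vadd dual_vscale scalars_def add scale)
  then show ?thesis
    using off by (simp add: dual_def[of "alg_dual sc"])
qed

lemma bidual_bound_norm: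
  assumes "m \<in> carr (alg_bidual sc)"
  obtains K where "K \<ge> 0"
    "\<And>f. f \<in> carr (alg_dual sc) \<Longrightarrow> norm (m f) \<le> K * vnorm (alg_dual sc) f"
proof -
  obtain K where "K \<ge> 0" "\<And>f L. f \<in> carr (alg_dual sc) \<Longrightarrow>
      (\<And>x. norm (f x) \<le> L * norm x) \<Longrightarrow> L \<ge> 0 \<Longrightarrow> norm (m f) \<le> K * L"
    using bidual_bound[OF assms] by blast
  then show thesis using that alg_dual_vnorm by blast
qed

text \<open>\<open>arens1_iter_lim\<close> gives this iterated limit for all approximating filters,
  and uniqueness makes it the value of \<open>THE\<close>. Nets disappear from here on: the two
  products differ only in which of \<open>m\<close> and \<open>n\<close> is applied first.\<close>

lemma arens1_eq:
  assumes "m \<in> carr (alg_bidual sc)" "n \<in> carr (alg_bidual sc)" "f \<in> carr (alg_dual sc)"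
  shows "arens1 sc m n f = m (\<lambda>a. n (\<lambda>b. f (a * b)))"
  unfolding arens1_def if_P[OF assms(3)]
  by (rule the1_equality[OF arens1_ex1[OF assms]]) (use assms arens1_iter_lim in blast)

lemma arens2_eq:
  assumes "m \<in> carr (alg_bidual sc)" "n \<in> carr (alg_bidual sc)" "f \<in> carr (alg_dual sc)"
  shows "arens2 sc m n f = n (\<lambda>b. m (\<lambda>a. f (a * b)))"
  unfolding arens2_def if_P[OF assms(3)]
  by (rule the1_equality[OF arens2_ex1[OF assms]]) (use assms arens2_iter_lim in blast)

text \<open>\<open>transp\<close> is cut off to 0 outside the carrier, so \<open>D''(n)\<close> can
  be computed at a product only once the product is known to lie in \<open>A**\<close>. The bound
  comes from submultiplicativity of the norm.\<close>

lemma arens1_bidual: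
  assumes m: "m \<in> carr (alg_bidual sc)" and n: "n \<in> carr (alg_bidual sc)"
  shows "arens1 sc m n \<in> carr (alg_bidual sc)"
proof -
  obtain K where K: "K \<ge> 0" "\<And>f L. f \<in> carr (alg_dual sc) \<Longrightarrow>
      (\<And>x. norm (f x) \<le> L * norm x) \<Longrightarrow> L \<ge> 0 \<Longrightarrow> norm (m f) \<le> K * L"
    using bidual_bound[OF m] by blast
  obtain M where M: "M \<ge> 0" "\<And>f L. f \<in> carr (alg_dual sc) \<Longrightarrow>
      (\<And>x. norm (f x) \<le> L * norm x) \<Longrightarrow> L \<ge> 0 \<Longrightarrow> norm (n f) \<le> M * L"
    using bidual_bound[OF n] by blast
  show ?thesis
  proof (rule bidual_memI)
    fix f assume "f \<notin> carr (alg_dual sc)"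
    then show "arens1 sc m n f = 0" by (simp add: arens1_def)
  next
    fix f g c assume f: "f \<in> carr (alg_dual sc)" and g: "g \<in> carr (alg_dual sc)"
    show "arens1 sc m n (\<lambda>x. f x + c * g x) = arens1 sc m n f + c * arens1 sc m n g"
      unfolding arens1_eq[OF m n f] arens1_eq[OF m n g]
        arens1_eq[OF m n alg_dual_comb[OF f g]]
        bidual_lin[OF n alg_dual_translate_right[OF f] alg_dual_translate_right[OF g]]
      by (rule bidual_lin[OF m bidual_act_right[OF n f] bidual_act_right[OF n g]])
  next
    fix f L assume f: "f \<in> carr (alg_dual sc)" and L: "\<And>x. norm (f x) \<le> L * norm x" "L \<ge> 0"
    have "norm (n (\<lambda>b. f (a * b))) \<le> (M * L) * norm a" for a
    proof -
      have "norm (f (a * b)) \<le> (L * norm a) * norm b" for b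
        using L(1)[of "a * b"] mult_left_mono[OF norm_mult_ineq[of a b] L(2)]
        by (simp add: mult.assoc)
      then have "norm (n (\<lambda>b. f (a * b))) \<le> M * (L * norm a)"
        using L(2) by (intro M(2) alg_dual_translate_right f) auto
      then show ?thesis by (simp add: mult.assoc)
    qed
    then have "norm (m (\<lambda>a. n (\<lambda>b. f (a * b)))) \<le> K * (M * L)"
      using M(1) L(2) by (intro K(2) bidual_act_right n f) auto
    then show "norm (arens1 sc m n f) \<le> (K * M) * L"
      by (simp add: arens1_eq m n f mult.assoc)
  qed
qed

lemma canon_bidual: "canon (alg sc) a \<in> carr (alg_bidual sc)"
  by (rule bidual_memI[where K = "norm a"])
     (auto simp: canon_def alg_dual_comb mult.commute)

text \<open>At \<open>D(b)\<close> this is what the summand \<open>a D(b)\<close> of the Leibniz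
  rule yields under \<open>p\<close>.\<close>

lemma arens1_canon:
  assumes p: "p \<in> carr (alg_bidual sc)" and f: "f \<in> carr (alg_dual sc)"
  shows "arens1 sc p (canon (alg sc) a) f = p (\<lambda>x. f (x * a))"
  unfolding arens1_eq[OF p canon_bidual f]
  by (simp add: canon_def alg_dual_translate_right f)

text \<open>The functional is \<open>D'(p)\<close>, with \<open>D'\<close> the transpose of
  \<open>D\<close>; the bounds of \<open>p\<close> and \<open>D\<close> multiply.\<close>

lemma transp_alg_dual:
  assumes D: "bdd_linear (alg sc) (alg_dual sc) D" and p: "p \<in> carr (alg_bidual sc)"
  shows "(\<lambda>a. p (D a)) \<in> carr (alg_dual sc)"
proof -
  have in_dual: "D a \<in> carr (alg_dual sc)" for a
    using D by (simp add: bdd_linear_def alg_def)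
  have add: "D (x + y) = (\<lambda>t. D x t + D y t)" and scale: "D (sc c x) = (\<lambda>t. c * D x t)" for x y c
    using D by (auto simp: bdd_linear_def dual_vadd dual_vscale) (auto simp: alg_def)
  obtain K where K: "K \<ge> 0"
    "\<And>f. f \<in> carr (alg_dual sc) \<Longrightarrow> norm (p f) \<le> K * vnorm (alg_dual sc) f"
    using bidual_bound_norm[OF p] by blast
  obtain M where M: "\<And>x. vnorm (alg_dual sc) (D x) \<le> M * norm x"
    using D by (auto simp: bdd_linear_def alg_def)
  have bd: "norm (p (D x)) \<le> (K * M) * norm x" for x
    using K(2)[OF in_dual, of x] mult_left_mono[OF M[of x] K(1)] by (simp add: mult.assoc)
  \<comment> \<open>With both functionals zero and scalar \<open>-1\<close>, linearity reads
    \<open>p 0 = p 0 - p 0\<close>.\<close>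
  have "p (\<lambda>x. 0) = 0"
    using bidual_lin[OF p alg_dual_zero alg_dual_zero, of "-1"] by simp
  then have p_scale: "p (D (sc c x)) = c * p (D x)" for c x
    unfolding scale using bidual_lin[OF p alg_dual_zero in_dual, of c x] by simp
  have p_add: "p (D (x + y)) = p (D x) + p (D y)" for x y
    unfolding add using bidual_lin[OF p in_dual in_dual, of x 1 y] by simp
  show ?thesis
    unfolding alg_dual_iff using p_add p_scale bd by blast
qed

lemma second_transp_eq:
  assumes "bdd_linear (alg sc) (alg_dual sc) D"
    and "m \<in> carr (alg_bidual sc)" "p \<in> carr (alg_bidual sc)"
  shows "second_transp sc D m p = m (\<lambda>a. p (D a))"
  using assms by (simp add: second_transp_def transp_def alg_def)

text \<open>The Leibniz rule of \<open>D\<close> is tested against \<open>p\<close> and then, as a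
  function of \<open>b\<close>, against \<open>n\<close>. The summand \<open>D(a) b\<close> becomes
  \<open>p (\<lambda>x. D a (b * x))\<close>, on which \<open>n\<close> gives the first Arens
  product.\<close>

lemma dual_derivation_transp_mult:
  assumes D: "dual_derivation (alg sc) (*) D"
    and n: "n \<in> carr (alg_bidual sc)" and p: "p \<in> carr (alg_bidual sc)"
  shows "n (\<lambda>b. p (D (a * b))) =
    n (\<lambda>b. arens1 sc p (canon (alg sc) a) (D b)) + arens1 sc n p (D a)"
proof -
  have bl: "bdd_linear (alg sc) (alg_dual sc) D"
    and leib: "D (a * b) = (\<lambda>x. D b (x * a) + D a (b * x))" for b
    using D by (auto simp: dual_derivation_def derivation_def dual_vadd dual_left_def
        dual_right_def) (auto simp: alg_def)
  have in_dual: "D a \<in> carr (alg_dual sc)" for a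
    using bl by (simp add: bdd_linear_def alg_def)
  have pa: "arens1 sc p (canon (alg sc) a) (D b) = p (\<lambda>x. D b (x * a))" for b
    by (rule arens1_canon[OF p in_dual])
  \<comment> \<open>The factor \<open>1\<close> brings the sum into the form of
    \<open>bidual_lin\<close>.\<close>
  have split: "p (D (a * b)) = arens1 sc p (canon (alg sc) a) (D b) + 1 * p (\<lambda>x. D a (b * x))" for b
    unfolding leib pa
    using bidual_lin[OF p alg_dual_translate_left alg_dual_translate_right, OF in_dual in_dual,
        of _ _ 1] by simp
  show ?thesis
    unfolding split arens1_eq[OF n p in_dual]
    using bidual_lin[OF n transp_alg_dual[OF bl arens1_bidual[OF p canon_bidual]]
        bidual_act_right[OF p in_dual], where c = 1]
    by simp
qed

text \<open>Both Leibniz rules compute \<open>D''(m.n)\<close> at \<open>p\<close>, with the common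
  summand \<open>D''(m)\<close> at \<open>n.p\<close>; cancelling it leaves the two products at
  \<open>f\<close>.\<close>

lemma arens_products_eq_at:
  assumes D: "dual_derivation (alg sc) (*) D"
    and DD: "dual_derivation (alg_bidual sc) (arens1 sc) (second_transp sc D)"
    and n: "n \<in> carr (alg_bidual sc)" and f: "f \<in> carr (alg_dual sc)"
    and nf: "second_transp sc D n = canon (alg_dual sc) f"
    and m: "m \<in> carr (alg_bidual sc)" and p: "p \<in> carr (alg_bidual sc)"
  shows "arens1 sc p m f = arens2 sc p m f"
proof -
  have bl: "bdd_linear (alg sc) (alg_dual sc) D"
    using D by (simp add: dual_derivation_def derivation_def)
  \<comment> \<open>Serves twice: for \<open>q = p.m\<close> in the rule of \<open>D''\<close>, and
    for \<open>q = p.a\<close> in the rule of \<open>D\<close>.\<close>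
  have repr: "n (\<lambda>b. q (D b)) = q f" if q: "q \<in> carr (alg_bidual sc)" for q
    using second_transp_eq[OF bl n q] nf q by (simp add: canon_def)
  have "second_transp sc D (arens1 sc m n) =
      vadd (dual (alg_bidual sc))
        (dual_left (alg_bidual sc) (arens1 sc) m (second_transp sc D n))
        (dual_right (alg_bidual sc) (arens1 sc) (second_transp sc D m) n)"
    using DD m n unfolding dual_derivation_def derivation_def by blast
  then have "second_transp sc D (arens1 sc m n) p =
      second_transp sc D n (arens1 sc p m) + second_transp sc D m (arens1 sc n p)"
    by (simp only: dual_vadd dual_left_def dual_right_def p if_True)
  then have "m (\<lambda>a. n (\<lambda>b. p (D (a * b)))) = arens1 sc p m f + m (\<lambda>a. arens1 sc n p (D a))"
    unfolding second_transp_eq[OF bl arens1_bidual[OF m n] p]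
      second_transp_eq[OF bl n arens1_bidual[OF p m]] repr[OF arens1_bidual[OF p m]]
      second_transp_eq[OF bl m arens1_bidual[OF n p]]
      arens1_eq[OF m n transp_alg_dual[OF bl p]] .
  \<comment> \<open>The same value, now from the rule of \<open>D\<close> on \<open>A\<close>. Here
    \<open>m\<close> stays outside \<open>p\<close>, which is the order of the second
    product.\<close>
  moreover have "m (\<lambda>a. n (\<lambda>b. p (D (a * b)))) =
      m (\<lambda>a. p (\<lambda>x. f (x * a)) + 1 * arens1 sc n p (D a))"
    unfolding dual_derivation_transp_mult[OF D n p] repr[OF arens1_bidual[OF p canon_bidual]]
      arens1_canon[OF p f] by simp
  moreover have "\<dots> = m (\<lambda>a. p (\<lambda>x. f (x * a))) + 1 * m (\<lambda>a. arens1 sc n p (D a))"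
    by (intro bidual_lin m bidual_act_left p f transp_alg_dual bl arens1_bidual n)
  ultimately show ?thesis by (simp add: arens2_eq p m f)
qed

end

theorem corollary3p4:
  fixes sc :: "'k::real_normed_field \<Rightarrow> 'a::{real_normed_algebra, banach} \<Rightarrow> 'a"
    and D :: "'a \<Rightarrow> 'a \<Rightarrow> 'k"
  assumes "banach_algebra sc"
    and "dual_derivation (alg sc) (*) D"
    and "canon (alg_dual sc) ` carr (alg_dual sc) \<subseteq> second_transp sc D ` carr (alg_bidual sc)"
    and "dual_derivation (alg_bidual sc) (arens1 sc) (second_transp sc D)"
  shows "arens_regular sc"
  unfolding arens_regular_def
proof (intro ballI ext)
  interpret banach_algebra sc by fact
  fix p m f
  assume p: "p \<in> carr (alg_bidual sc)" and m: "m \<in> carr (alg_bidual sc)"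
  show "arens1 sc p m f = arens2 sc p m f"
  proof (cases "f \<in> carr (alg_dual sc)")
    case True
    \<comment> \<open>The preimage \<open>n\<close> depends on \<open>f\<close>, so the products are
      compared one functional at a time.\<close>
    then have "canon (alg_dual sc) f \<in> second_transp sc D ` carr (alg_bidual sc)"
      by (rule subsetD[OF assms(3) imageI])
    then obtain n where
      n: "n \<in> carr (alg_bidual sc)" "canon (alg_dual sc) f = second_transp sc D n"
      by (rule imageE)
    show ?thesis
      by (rule arens_products_eq_at[OF assms(2,4) n(1) True n(2)[symmetric] m p])
  next
    \<comment> \<open>Both products are 0 here by the totality convention.\<close>
    case False
    then show ?thesis by (simp add: arens1_def arens2_def)
  qed
qed

end
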